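(* Let $m\geq 2$ be a natural number. For each integer $j$ with $0\leq j\leq \frac{m-1}{2}$ the following identity holds: $$(-1)^{j}\left[\binom{m-1}{2j}+\sum_{k=0}^{j-1}\left[\binom{m-1}{2k}\binom{m-1}{2j-2k}-\binom{m-1}{2k+1}\binom{m-1}{2j-2k-1}\right]\right]=\binom{m-1}{j}.$$
   Context: $\binom{a}{b}$ denotes the usual binomial coefficient. An empty sum (as occurs when $j=0$) is equal to $0$. *)

theory Defs
  imports Complex_Main
begin

end

theory Submission imports Defs "HOL-Computational_Algebra.Polynomial"
begin

text \<open>Both sides are, up to the sign, the coefficient of $x^{2j}$ in
  $(1-x)^n (1+x)^n = (1-x^2)^n$ with $n = m-1$: the isolated binomial coefficient on the
  left is the term of index $2j$ of the convolution, and the sum pairs its terms of index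
  $2k$ and $2k+1$.\<close>

text \<open>This is the binomial theorem; for \<open>i > n\<close> both sides vanish, the left one
  by degree.\<close>

lemma coeff_one_linear_power:
  fixes c :: "'a :: comm_semiring_1"
  shows "coeff ([:1, c:] ^ n) i = of_nat (n choose i) * c ^ i"
proof (cases "i \<le> n")
  case True
  then show ?thesis by (simp add: coeff_linear_poly_power)
next
  case False
  moreover have "degree ([:1, c:] ^ n) \<le> 1 * n"
    by (rule order_trans[OF degree_power_le]) (simp add: mult_right_mono)
  ultimately show ?thesis by (simp add: coeff_eq_0 binomial_eq_0)
qed

text \<open>One more factor \<open>[:1, 0, c:]\<close> adds a copy scaled by \<open>c\<close> and
  shifted by two places, so on even indices the recursion is Pascal's rule.\<close>

lemma coeff_one_quadratic_power_even:
  fixes c :: "'a :: comm_semiring_1"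
  shows "coeff ([:1, 0, c:] ^ n) (2 * j) = of_nat (n choose j) * c ^ j"
proof (induction n arbitrary: j)
  case 0
  then show ?case by (cases j) simp_all
next
  case (Suc n)
  have "[:1, 0, c:] ^ Suc n
      = [:1, 0, c:] ^ n + pCons 0 (pCons 0 (smult c ([:1, 0, c:] ^ n)))"
    by simp
  then show ?case
    using Suc.IH[of j] Suc.IH[of "j - 1"] by (cases j) (simp_all add: algebra_simps)
qed

lemma alternating_choose_convolution:
  "(\<Sum>i\<le>2 * j. (-1) ^ i * int (n choose i) * int (n choose (2 * j - i)))
    = (-1) ^ j * int (n choose j)"
proof -
  have "[:1, -1:] ^ n * [:1, 1:] ^ n = ([:1, 0, -1:] :: int poly) ^ n"
    by (simp flip: power_mult_distrib)
  then have "coeff ([:1, -1:] ^ n * [:1, 1:] ^ n) (2 * j) = (-1) ^ j * int (n choose j)"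
    by (simp add: coeff_one_quadratic_power_even)
  then show ?thesis
    \<comment> \<open>The sign \<open>(-1) ^ i\<close> is the power of \<open>c = -1\<close> from
      the first factor; the second has \<open>c = 1\<close>.\<close>
    unfolding coeff_mult coeff_one_linear_power by (simp add: mult_ac)
qed

lemma sum_atMost_even_pairs:
  fixes f :: "nat \<Rightarrow> 'a :: comm_monoid_add"
  shows "(\<Sum>i\<le>2 * j. f i) = f (2 * j) + (\<Sum>k\<in>{0..<j}. f (2 * k) + f (2 * k + 1))"
  by (induction j) (simp_all add: ac_simps)

theorem theorem1:
  fixes m j :: nat
  assumes "m \<ge> 2"
    and "real j \<le> (real m - 1) / 2"
  shows "(-1) ^ j *
      (int ((m - 1) choose (2 * j)) +
       (\<Sum>k\<in>{0..<j}.
          int ((m - 1) choose (2 * k)) * int ((m - 1) choose (2 * j - 2 * k)) -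
          int ((m - 1) choose (2 * k + 1)) * int ((m - 1) choose (2 * j - 2 * k - 1))))
    = int ((m - 1) choose j)"
proof -
  let ?n = "m - 1"
  have "int (?n choose (2 * j)) +
       (\<Sum>k\<in>{0..<j}.
          int (?n choose (2 * k)) * int (?n choose (2 * j - 2 * k)) -
          int (?n choose (2 * k + 1)) * int (?n choose (2 * j - 2 * k - 1)))
      = (\<Sum>i\<le>2 * j. (-1) ^ i * int (?n choose i) * int (?n choose (2 * j - i)))"
    \<comment> \<open>The unpaired top term \<open>i = 2 * j\<close> has sign \<open>+1\<close> and
      second factor \<open>?n choose 0 = 1\<close>; in each pair the odd index
      \<open>2 * k + 1\<close> supplies the minus sign.\<close>
    by (simp add: sum_atMost_even_pairs)
  also have "\<dots> = (-1) ^ j * int (?n choose j)"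
    by (rule alternating_choose_convolution)
  finally show ?thesis
    \<comment> \<open>The two signs cancel, since
      \<open>(-1) ^ j * (-1) ^ j = ((-1) * (-1)) ^ j = 1\<close>.\<close>
    by (simp flip: mult.assoc power_mult_distrib)
qed

end
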